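(* Let $b$ be a non-negative integer, and let $\delta_1,\delta_2\in\{\pm 1\}$. Then for any integer $n$ satisfying $0\leq n\leq b$, we have \begin{align*} &\sum_{j=0}^b\binom{j}{n}M_{\mathcal{A}}(b-j+1,j+1;\delta_1,\delta_1\delta_2)+\sum_{j=0}^b\binom{j}{b-n}M_{\mathcal{A}}(b-j+1,j+1;\delta_2,\delta_1\delta_2)\\ &=(-1)^{n+1}M_{\mathcal{A}}(b-n+1,n+1;\delta_1,-\delta_2). \end{align*}
   Context: Let $\mathcal{P}$ be the set of primes and $\mathcal{A}:=\prod_{p\in\mathcal{P}}(\mathbb{Z}/p\mathbb{Z})\big/\bigoplus_{p\in\mathcal{P}}(\mathbb{Z}/p\mathbb{Z})$, in which an element is determined by its components at all but finitely many primes. For positive integers $k_1,\ldots,k_r$, signs $\varepsilon_1,\ldots,\varepsilon_r\in\{\pm1\}$ and a positive integer $N$, put $$M_N(k_1,\ldots,k_r;\varepsilon_1,\ldots,\varepsilon_r):=\sum_{0<m_1<\cdots<m_r<N}\frac{(1+\varepsilon_1(-1)^{m_1})\cdots(1+\varepsilon_r(-1)^{m_r})}{m_1^{k_1}\cdots m_r^{k_r}},$$ and define the finite multiple mixed value $M_{\mathcal{A}}(k_1,\ldots,k_r;\varepsilon_1,\ldots,\varepsilon_r):=\bigl(M_p(k_1,\ldots,k_r;\varepsilon_1,\ldots,\varepsilon_r)\bmod p\bigr)_{p\in\mathcal{P}}\in\mathcal{A}$. Binomial coefficients $\binom{j}{n}$ are $0$ if $n>j$. *)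

theory Defs
  imports Complex_Main "HOL-Number_Theory.Number_Theory"
begin

text \<open>
  The ring \<open>\<Prod>\<^sub>p \<int>/p\<int>\<close> over all primes \<open>p\<close>, with componentwise operations; an element of
  \<open>\<int>/p\<int>\<close> is represented by its least non-negative residue.
\<close>

typedef prod_zmod = "\<Pi>\<^sub>E p\<in>{p::nat. prime p}. {0..<int p}"
  by (rule exI[of _ "\<lambda>p\<in>{p. prime p}. 0"]) (auto simp: prime_gt_0_nat)

setup_lifting type_definition_prod_zmod

lift_definition component :: "prod_zmod \<Rightarrow> nat \<Rightarrow> int" is "\<lambda>f p. f p" .

lift_definition residues_of :: "(nat \<Rightarrow> int) \<Rightarrow> prod_zmod"
  is "\<lambda>f. \<lambda>p\<in>{p. prime p}. f p mod int p"
  by (auto simp: prime_gt_0_nat)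

lemma component_residues_of:
  "prime p \<Longrightarrow> component (residues_of f) p = f p mod int p"
  by transfer simp

lemma component_mod [simp]:
  "prime p \<Longrightarrow> component x p mod int p = component x p"
  by transfer (auto simp: PiE_iff)

lemma prod_zmod_eqI:
  "(\<And>p. prime p \<Longrightarrow> component x p = component y p) \<Longrightarrow> x = y"
  by transfer (rule PiE_ext, auto)

instantiation prod_zmod :: comm_ring_1
begin

definition "0 = residues_of (\<lambda>p. 0)"
definition "1 = residues_of (\<lambda>p. 1)"
definition "x + y = residues_of (\<lambda>p. component x p + component y p)"
definition "- x = residues_of (\<lambda>p. - component x p)"
definition "x - y = residues_of (\<lambda>p. component x p - component y p)"
definition "x * y = residues_of (\<lambda>p. component x p * component y p)"

instance
proof
  fix a b c :: prod_zmod
  note defs = zero_prod_zmod_def one_prod_zmod_def plus_prod_zmod_def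
    uminus_prod_zmod_def minus_prod_zmod_def times_prod_zmod_def component_residues_of
  show "a + b + c = a + (b + c)"
    by (rule prod_zmod_eqI) (simp add: defs mod_simps algebra_simps)
  show "a + b = b + a"
    by (rule prod_zmod_eqI) (simp add: defs algebra_simps)
  show "0 + a = a" "- a + a = 0" "a - b = a + - b"
    by (rule prod_zmod_eqI, simp add: defs mod_simps)+
  show "a * b * c = a * (b * c)" "a * b = b * a" "(a + b) * c = a * c + b * c"
    by (rule prod_zmod_eqI, simp add: defs mod_simps algebra_simps)+
  show "1 * a = a"
    by (rule prod_zmod_eqI) (simp add: defs mod_simps)
  have "component (0::prod_zmod) 2 \<noteq> component 1 2"
    by (simp add: defs)
  then show "(0::prod_zmod) \<noteq> 1"
    by metis
qed

end

lemmas component_simps =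
  zero_prod_zmod_def one_prod_zmod_def plus_prod_zmod_def
  uminus_prod_zmod_def minus_prod_zmod_def times_prod_zmod_def component_residues_of

definition direct_sum :: "prod_zmod set" where
  "direct_sum = {x. finite {p. prime p \<and> component x p \<noteq> 0}}"

lemma diff_in_direct_sum_iff:
  "x - y \<in> direct_sum \<longleftrightarrow> finite {p. prime p \<and> component x p \<noteq> component y p}"
proof -
  have "component (x - y) p \<noteq> 0 \<longleftrightarrow> component x p \<noteq> component y p" if "prime p" for p
  proof -
    have "component (x - y) p = 0 \<longleftrightarrow> component x p mod int p = component y p mod int p"
      using that by (simp only: component_simps mod_eq_dvd_iff dvd_eq_mod_eq_0)
    then show ?thesis
      using that by simp
  qed
  then have "{p. prime p \<and> component (x - y) p \<noteq> 0}
      = {p. prime p \<and> component x p \<noteq> component y p}"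
    by auto
  then show ?thesis
    by (simp add: direct_sum_def)
qed

quotient_type ring_A = prod_zmod / "\<lambda>x y. x - y \<in> direct_sum"
proof (rule equivpI)
  show "reflp (\<lambda>x y. x - y \<in> direct_sum)"
    by (simp add: reflp_def diff_in_direct_sum_iff)
  show "symp (\<lambda>x y. x - y \<in> direct_sum)"
    by (simp add: symp_def diff_in_direct_sum_iff eq_commute)
  show "transp (\<lambda>x y. x - y \<in> direct_sum)"
    unfolding transp_def diff_in_direct_sum_iff
  proof (intro allI impI)
    fix x y z
    assume "finite {p. prime p \<and> component x p \<noteq> component y p}"
      "finite {p. prime p \<and> component y p \<noteq> component z p}"
    then show "finite {p. prime p \<and> component x p \<noteq> component z p}"
      by (rule rev_finite_subset[OF finite_UnI]) auto
  qed
qed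

lemma direct_sum_ideal:
  "x \<in> direct_sum \<Longrightarrow> y \<in> direct_sum \<Longrightarrow> x + y \<in> direct_sum"
  "x \<in> direct_sum \<Longrightarrow> - x \<in> direct_sum"
  "x \<in> direct_sum \<Longrightarrow> x * z \<in> direct_sum"
proof -
  assume x: "x \<in> direct_sum"
  show "- x \<in> direct_sum" "x * z \<in> direct_sum"
    using x unfolding direct_sum_def mem_Collect_eq
    by (rule rev_finite_subset, auto simp: component_simps)+
  assume "y \<in> direct_sum"
  with x show "x + y \<in> direct_sum"
    unfolding direct_sum_def mem_Collect_eq
    by (rule rev_finite_subset[OF finite_UnI]) (auto simp: component_simps)
qed

instantiation ring_A :: comm_ring_1
begin

lift_definition zero_ring_A :: ring_A is 0 .
lift_definition one_ring_A :: ring_A is 1 .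

lift_definition plus_ring_A :: "ring_A \<Rightarrow> ring_A \<Rightarrow> ring_A" is "(+)"
proof -
  fix a a' b b' :: prod_zmod
  assume "a - a' \<in> direct_sum" "b - b' \<in> direct_sum"
  then have "(a - a') + (b - b') \<in> direct_sum"
    by (rule direct_sum_ideal(1))
  then show "a + b - (a' + b') \<in> direct_sum"
    by (simp add: algebra_simps)
qed

lift_definition uminus_ring_A :: "ring_A \<Rightarrow> ring_A" is uminus
proof -
  fix a a' :: prod_zmod
  assume "a - a' \<in> direct_sum"
  then have "- (a - a') \<in> direct_sum"
    by (rule direct_sum_ideal(2))
  then show "- a - - a' \<in> direct_sum"
    by simp
qed

lift_definition minus_ring_A :: "ring_A \<Rightarrow> ring_A \<Rightarrow> ring_A" is "(-)"
proof -
  fix a a' b b' :: prod_zmod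
  assume "a - a' \<in> direct_sum" "b - b' \<in> direct_sum"
  then have "(a - a') + - (b - b') \<in> direct_sum"
    by (intro direct_sum_ideal(1) direct_sum_ideal(2))
  then show "a - b - (a' - b') \<in> direct_sum"
    by (simp add: algebra_simps)
qed

lift_definition times_ring_A :: "ring_A \<Rightarrow> ring_A \<Rightarrow> ring_A" is "(*)"
proof -
  fix a a' b b' :: prod_zmod
  assume "a - a' \<in> direct_sum" "b - b' \<in> direct_sum"
  then have "(a - a') * b + (b - b') * a' \<in> direct_sum"
    by (intro direct_sum_ideal(1) direct_sum_ideal(3))
  then show "a * b - a' * b' \<in> direct_sum"
    by (simp add: algebra_simps)
qed

instance
proof
  have eqI: "x = y \<Longrightarrow> x - y \<in> direct_sum" for x y
    by (simp only: diff_in_direct_sum_iff) simp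
  fix a b c :: ring_A
  show "a + b + c = a + (b + c)"
    by transfer (rule eqI, rule add.assoc)
  show "a + b = b + a"
    by transfer (rule eqI, rule add.commute)
  show "0 + a = a"
    by transfer (rule eqI, rule add_0_left)
  show "- a + a = 0"
    by transfer (rule eqI, rule left_minus)
  show "a - b = a + - b"
    by transfer (rule eqI, rule diff_conv_add_uminus)
  show "a * b * c = a * (b * c)"
    by transfer (rule eqI, rule mult.assoc)
  show "a * b = b * a"
    by transfer (rule eqI, rule mult.commute)
  show "1 * a = a"
    by transfer (rule eqI, rule mult_1_left)
  show "(a + b) * c = a * c + b * c"
    by transfer (rule eqI, rule distrib_right)
  have "\<not> finite {p::nat. prime p}"
    by (rule primes_infinite)
  moreover have "{p. prime p \<and> component 0 p \<noteq> component 1 p} = {p. prime p}"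
    by (auto simp: component_simps prime_gt_1_nat)
  ultimately have "(0::prod_zmod) - 1 \<notin> direct_sum"
    by (simp only: diff_in_direct_sum_iff not_False_eq_True)
  then show "(0::ring_A) \<noteq> 1"
    by transfer
qed

end

definition mod_prime :: "nat \<Rightarrow> rat \<Rightarrow> int" where
  \<comment> \<open>The residue of a rational number whose reduced denominator is coprime to \<open>p\<close>; the value
     is \<open>0\<close> by convention if \<open>p\<close> divides the denominator.\<close>
  "mod_prime p x =
     (let (a, b) = quotient_of x in a * modular_inverse (int p) b mod int p)"

definition M :: "nat \<Rightarrow> nat list \<Rightarrow> int list \<Rightarrow> rat" where
  \<comment> \<open>The list \<open>ms\<close> is \<open>m\<^sub>1 < \<dots> < m\<^sub>r\<close>, with \<open>r\<close> the length of \<open>ks\<close> and indices shifted to start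
     at \<open>0\<close>; the sign list is meant to have length \<open>r\<close> as well.\<close>
  "M N ks es =
     (\<Sum>ms | length ms = length ks \<and> sorted_wrt (<) ms \<and> set ms \<subseteq> {0<..<N}.
        (\<Prod>i<length ks. 1 + of_int (es ! i) * (- 1) ^ (ms ! i)) /
        (\<Prod>i<length ks. of_nat (ms ! i) ^ (ks ! i)))"

definition M_A :: "nat list \<Rightarrow> int list \<Rightarrow> ring_A" where
  \<comment> \<open>All denominators in \<open>M p\<close> are products of integers in \<open>{0<..<p}\<close>, so reduction mod \<open>p\<close> is
     always legitimate.\<close>
  "M_A ks es = abs_ring_A (residues_of (\<lambda>p. mod_prime p (M p ks es)))"

end

theory Submission
  imports Defs
begin

text \<open>
  Substituting \<open>m\<^sub>2 = p - c\<close> on the right-hand side and \<open>m\<^sub>2 = a + c\<close> on the left-hand side turns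
  all double sums into sums over the triangle \<open>a, c > 0\<close>, \<open>a + c < p\<close> with the same weight
  \<open>(1 + \<delta>\<^sub>1 (-1)\<^sup>a) (1 + \<delta>\<^sub>2 (-1)\<^sup>c)\<close> (for the right-hand side, \<open>p\<close> has to be odd). The claim is then the
  partial fraction decomposition of \<open>1 / (a\<^sup>b\<^sup>-\<^sup>n\<^sup>+\<^sup>1 c\<^sup>n\<^sup>+\<^sup>1)\<close> with respect to \<open>a + c\<close>, summed over the
  triangle.
\<close>

subsection \<open>Partial fractions\<close>

text \<open>For a fixed pair (a, c) this is the inner sum over j on the left-hand side, with
  \<open>x\<close> = 1/a or 1/c and \<open>y\<close> = 1/(a + c). Treating the reciprocals as ring
  variables makes the partial fraction identity polynomial.\<close>

definition binomial_power_sum :: "'a::comm_ring_1 \<Rightarrow> 'a \<Rightarrow> nat \<Rightarrow> nat \<Rightarrow> 'a" where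
  "binomial_power_sum x y b k = (\<Sum>j=0..b. of_nat (j choose k) * (x ^ (b - j + 1) * y ^ (j + 1)))"

lemma binomial_power_sum_eq_0: "b < k \<Longrightarrow> binomial_power_sum x y b k = 0"
  by (auto simp: binomial_power_sum_def binomial_eq_0 intro!: sum.neutral)

lemma binomial_power_sum_Suc_0:
  "binomial_power_sum x y (Suc b) 0 = y * x ^ (b + 2) + y * binomial_power_sum x y b 0"
  unfolding binomial_power_sum_def sum.atLeast0_atMost_Suc_shift
  by (simp add: sum_distrib_left algebra_simps)

text \<open>Shifting j pulls out a factor \<open>y\<close>, Pascal's rule splits the coefficient,
  and the term j = 0 drops out because its coefficient is 0.\<close>

lemma binomial_power_sum_Suc_Suc:
  "binomial_power_sum x y (Suc b) (Suc k)
     = y * (binomial_power_sum x y b k + binomial_power_sum x y b (Suc k))"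
  unfolding binomial_power_sum_def sum.atLeast0_atMost_Suc_shift
  by (simp add: sum_distrib_left algebra_simps flip: sum.distrib)

text \<open>The hypothesis is 1/(a + c) * (1/a + 1/c) = 1/(a c) without division. Each induction
  step trades a factor \<open>x * z\<close> for \<open>y * (x + z)\<close>, which matches the
  recursions of \<open>binomial_power_sum\<close>.\<close>

lemma partial_fractions:
  fixes x y z :: "'a::comm_ring_1"
  assumes "y * (x + z) = x * z"
  shows "x ^ (s + 1) * z ^ (t + 1) = binomial_power_sum x y (s + t) t + binomial_power_sum z y (s + t) s"
proof (induction "s + t" arbitrary: s t)
  case 0
  then show ?case
    using assms by (simp add: binomial_power_sum_def algebra_simps)
next
  case (Suc b)
  have step: "x ^ (s + 1) * z ^ (t + 1) = y * (x ^ (s + 1) * z ^ t + x ^ s * z ^ (t + 1))"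
  proof -
    have "x ^ (s + 1) * z ^ (t + 1) = x ^ s * z ^ t * (x * z)"
      by (simp add: algebra_simps)
    also have "\<dots> = y * (x ^ (s + 1) * z ^ t + x ^ s * z ^ (t + 1))"
      by (simp add: algebra_simps flip: assms)
    finally show ?thesis .
  qed
  show ?case
  proof (cases s)
    case 0
    then have t: "t = Suc b" using Suc.hyps by simp
    have "x ^ (0 + 1) * z ^ (b + 1) = binomial_power_sum x y (0 + b) b + binomial_power_sum z y (0 + b) 0"
      by (rule Suc.hyps(1)) simp
    \<comment> \<open>The pure power of \<open>z\<close> left over by \<open>step\<close> is the
      extra term of \<open>binomial_power_sum_Suc_0\<close>.\<close>
    with 0 t show ?thesis
      unfolding step
      by (simp add: binomial_power_sum_Suc_0 binomial_power_sum_Suc_Suc binomial_power_sum_eq_0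
          distrib_left add_ac)
  next
    case s: (Suc s')
    have IH: "x ^ (s' + 1) * z ^ (t + 1) = binomial_power_sum x y (s' + t) t + binomial_power_sum z y (s' + t) s'"
      by (rule Suc.hyps(1)) (use s Suc.hyps(2) in simp)
    show ?thesis
    proof (cases t)
      case 0
      with s IH show ?thesis
        unfolding step
        by (simp add: binomial_power_sum_Suc_0 binomial_power_sum_Suc_Suc binomial_power_sum_eq_0
            distrib_left add_ac)
    next
      case t: (Suc t')
      have "x ^ (s + 1) * z ^ (t' + 1) = binomial_power_sum x y (s + t') t' + binomial_power_sum z y (s + t') s"
        by (rule Suc.hyps(1)) (use t Suc.hyps(2) in simp)
      then have IH': "x ^ (s + 1) * z ^ t = binomial_power_sum x y (s + t') t' + binomial_power_sum z y (s + t') s"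
        using t by simp
      have "x ^ s * z ^ (t + 1) = binomial_power_sum x y (s' + t) t + binomial_power_sum z y (s' + t) s'"
        using IH s by simp
      with IH' show ?thesis
        unfolding step by (simp add: s t binomial_power_sum_Suc_Suc distrib_left add_ac)
    qed
  qed
qed

subsection \<open>Reduction of rational numbers modulo a prime\<close>

text \<open>A relation instead of a function: the fraction need not be reduced and \<open>u\<close>
  is any representative, so for sums and products it suffices to multiply denominators.\<close>

definition has_residue :: "nat \<Rightarrow> rat \<Rightarrow> int \<Rightarrow> bool" where
  "has_residue p x u \<longleftrightarrow>
     (\<exists>a b. x = of_int a / of_int b \<and> \<not> int p dvd b \<and> [u * b = a] (mod int p))"

lemma has_residue_of_int: "prime p \<Longrightarrow> has_residue p (of_int a) a"
  unfolding has_residue_def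
  by (intro exI[of _ a] exI[of _ 1]) (auto dest: prime_gt_1_nat)

lemma has_residue_add:
  assumes p: "prime p" and "has_residue p x u" "has_residue p y v"
  shows "has_residue p (x + y) (u + v)"
proof -
  obtain a b c d where *: "x = of_int a / of_int b" "\<not> int p dvd b" "[u * b = a] (mod int p)"
    "y = of_int c / of_int d" "\<not> int p dvd d" "[v * d = c] (mod int p)"
    using assms unfolding has_residue_def by blast
  then have "b \<noteq> 0" "d \<noteq> 0" by auto
  then have "x + y = of_int (a * d + c * b) / of_int (b * d)"
    using * by (simp add: field_simps)
  moreover have "\<not> int p dvd b * d"
    using * p by (simp add: prime_dvd_mult_iff)
  moreover have "[u * b * d + v * d * b = a * d + c * b] (mod int p)"
    using * by (intro cong_add cong_mult) auto
  then have "[(u + v) * (b * d) = a * d + c * b] (mod int p)"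
    by (simp add: algebra_simps)
  ultimately show ?thesis
    unfolding has_residue_def by blast
qed

lemma has_residue_mult:
  assumes p: "prime p" and "has_residue p x u" "has_residue p y v"
  shows "has_residue p (x * y) (u * v)"
proof -
  obtain a b c d where *: "x = of_int a / of_int b" "\<not> int p dvd b" "[u * b = a] (mod int p)"
    "y = of_int c / of_int d" "\<not> int p dvd d" "[v * d = c] (mod int p)"
    using assms unfolding has_residue_def by blast
  have "x * y = of_int (a * c) / of_int (b * d)"
    using * by simp
  moreover have "\<not> int p dvd b * d"
    using * p by (simp add: prime_dvd_mult_iff)
  moreover have "[(u * b) * (v * d) = a * c] (mod int p)"
    using * by (intro cong_mult) auto
  then have "[(u * v) * (b * d) = a * c] (mod int p)"
    by (simp add: algebra_simps)
  ultimately show ?thesis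
    unfolding has_residue_def by blast
qed

lemma has_residue_power:
  "prime p \<Longrightarrow> has_residue p x u \<Longrightarrow> has_residue p (x ^ k) (u ^ k)"
  by (induction k) (use has_residue_of_int[of p 1] in \<open>auto intro: has_residue_mult\<close>)

lemma has_residue_sum:
  "prime p \<Longrightarrow> (\<And>i. i \<in> I \<Longrightarrow> has_residue p (f i) (g i)) \<Longrightarrow> has_residue p (sum f I) (sum g I)"
  by (induction I rule: infinite_finite_induct)
     (use has_residue_of_int[of p 0] in \<open>auto intro: has_residue_add\<close>)

lemma has_residue_inverse:
  "\<not> int p dvd c \<Longrightarrow> [v * c = 1] (mod int p) \<Longrightarrow> has_residue p (1 / of_int c) v"
  unfolding has_residue_def by (intro exI[of _ 1] exI[of _ c]) simp

text \<open>Cross-multiplying the two fractions gives a d = c b, and the factor b d, being prime to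
  p, can be cancelled.\<close>

lemma has_residue_unique:
  assumes p: "prime p" and "has_residue p x u" "has_residue p x v"
  shows "[u = v] (mod int p)"
proof -
  obtain a b c d where *: "x = of_int a / of_int b" "\<not> int p dvd b" "[u * b = a] (mod int p)"
    "x = of_int c / of_int d" "\<not> int p dvd d" "[v * d = c] (mod int p)"
    using assms unfolding has_residue_def by blast
  then have "b \<noteq> 0" "d \<noteq> 0" by auto
  then have "(of_int (a * d) :: rat) = of_int (c * b)"
    using *(1,4) by (simp add: field_simps)
  then have eq: "a * d = c * b"
    by (simp only: of_int_eq_iff)
  have "[u * b * d = a * d] (mod int p)" "[v * d * b = c * b] (mod int p)"
    using * by (intro cong_mult cong_refl; simp)+
  then have "[u * (b * d) = v * (b * d)] (mod int p)"
    using eq by (auto simp: mult_ac cong_def)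
  moreover have "coprime (b * d) (int p)"
    using * p by (auto simp: coprime_commute[of _ "int p"] intro: prime_imp_coprime)
  ultimately show ?thesis
    by (simp add: cong_mult_rcancel)
qed

text \<open>The reduced denominator divides every other denominator of \<open>x\<close>, so it is
  prime to p and the modular inverse in \<open>mod_prime\<close> is a genuine one.\<close>

lemma has_residue_mod_prime:
  assumes p: "prime p" and "has_residue p x u"
  shows "has_residue p x (mod_prime p x)"
proof -
  obtain a b where q: "quotient_of x = (a, b)"
    by fastforce
  then have x: "x = of_int a / of_int b" and b: "b > 0" and ab: "coprime a b"
    by (auto dest: quotient_of_div quotient_of_denom_pos quotient_of_coprime)
  obtain c d where *: "x = of_int c / of_int d" "\<not> int p dvd d"
    using assms unfolding has_residue_def by blast
  have "(of_int (a * d) :: rat) = of_int (c * b)"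
    using * x b by (cases "d = 0") (auto simp: field_simps)
  then have "a * d = c * b"
    by (simp only: of_int_eq_iff)
  then have "b dvd d"
    using ab by (metis coprime_commute coprime_dvd_mult_right_iff dvd_triv_right)
  then have pb: "\<not> int p dvd b"
    using * dvd_trans by blast
  then have "coprime (int p) b"
    using p by (simp add: prime_imp_coprime)
  then have "[b * modular_inverse (int p) b = 1] (mod int p)"
    using p by (simp add: cong_modular_inverse1 coprime_commute prime_gt_0_nat)
  then have "[a * (b * modular_inverse (int p) b) = a * 1] (mod int p)"
    by (intro cong_mult cong_refl)
  then have "[mod_prime p x * b = a] (mod int p)"
    using q by (simp add: mod_prime_def cong_def mod_simps mult_ac)
  then show ?thesis
    unfolding has_residue_def using x pb by blast
qed

subsection \<open>Elements of \<open>\<A>\<close> given by integer sequences\<close>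

definition residue_class :: "(nat \<Rightarrow> int) \<Rightarrow> ring_A" where
  "residue_class f = abs_ring_A (residues_of f)"

text \<open>Finitely many components do not matter in \<open>ring_A\<close>. Discarding p = 2
  provides the odd p that the substitution m = p - c requires.\<close>

lemma residue_class_eqI:
  assumes "\<And>p. prime p \<Longrightarrow> p \<noteq> 2 \<Longrightarrow> [f p = g p] (mod int p)"
  shows "residue_class f = residue_class g"
proof -
  have "component (residues_of f) p = component (residues_of g) p" if "prime p" "p \<noteq> 2" for p
    using assms[OF that] that by (simp add: component_residues_of cong_def)
  then have "{p. prime p \<and> component (residues_of f) p \<noteq> component (residues_of g) p} \<subseteq> {2}"
    by blast
  then have "finite {p. prime p \<and> component (residues_of f) p \<noteq> component (residues_of g) p}"
    by (rule finite_subset) simp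
  then show ?thesis
    by (simp add: residue_class_def ring_A.abs_eq_iff diff_in_direct_sum_iff)
qed

lemma residue_class_add: "residue_class f + residue_class g = residue_class (\<lambda>p. f p + g p)"
proof -
  have "residues_of f + residues_of g = residues_of (\<lambda>p. f p + g p)"
    by (rule prod_zmod_eqI) (simp add: component_simps mod_simps)
  then show ?thesis
    by (simp add: residue_class_def plus_ring_A.abs_eq)
qed

lemma residue_class_uminus: "- residue_class f = residue_class (\<lambda>p. - f p)"
proof -
  have "- residues_of f = residues_of (\<lambda>p. - f p)"
    by (rule prod_zmod_eqI) (simp add: component_simps mod_simps)
  then show ?thesis
    by (simp add: residue_class_def uminus_ring_A.abs_eq)
qed

lemma residue_class_0: "residue_class (\<lambda>p. 0) = 0"
  by (simp add: residue_class_def zero_ring_A_def zero_prod_zmod_def)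

lemma residue_class_of_nat_mult: "of_nat k * residue_class f = residue_class (\<lambda>p. int k * f p)"
  by (induction k) (simp_all add: residue_class_0 residue_class_add distrib_right)

lemma residue_class_sum: "(\<Sum>i\<in>I. residue_class (f i)) = residue_class (\<lambda>p. \<Sum>i\<in>I. f i p)"
  by (induction I rule: infinite_finite_induct) (simp_all add: residue_class_0 residue_class_add)

lemma residue_class_sign_mult: "(-1) ^ k * residue_class f = residue_class (\<lambda>p. (-1) ^ k * f p)"
  by (induction k) (simp_all add: residue_class_uminus)

subsection \<open>Double sums over the triangle\<close>

definition triangle :: "nat \<Rightarrow> (nat \<times> nat) set" where
  "triangle N = {(a, c). 0 < a \<and> 0 < c \<and> a + c < N}"

definition weight :: "int \<Rightarrow> nat \<Rightarrow> int" where
  "weight \<epsilon> m = 1 + \<epsilon> * (- 1) ^ m"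

lemma M_depth_2:
  "M N [k, l] [\<epsilon>, \<eta>] = (\<Sum>(a, m) | 0 < a \<and> a < m \<and> m < N.
     of_int (weight \<epsilon> a * weight \<eta> m) * ((1 / of_nat a) ^ k * (1 / of_nat m) ^ l))"
  unfolding M_def
proof (rule sum.reindex_bij_witness[where i = "\<lambda>(a, m). [a, m]" and j = "\<lambda>ms. (ms ! 0, ms ! 1)"])
  fix ms assume "ms \<in> {ms. length ms = length [k, l] \<and> sorted_wrt (<) ms \<and> set ms \<subseteq> {0<..<N}}"
  then obtain a m where ms: "ms = [a, m]" "0 < a" "a < m" "m < N"
    by (auto simp: length_Suc_conv)
  show "(case (ms ! 0, ms ! 1) of (a, m) \<Rightarrow> [a, m]) = ms"
    "(ms ! 0, ms ! 1) \<in> {(a, m). 0 < a \<and> a < m \<and> m < N}"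
    "(case (ms ! 0, ms ! 1) of (a, m) \<Rightarrow>
        of_int (weight \<epsilon> a * weight \<eta> m) * ((1 / of_nat a) ^ k * (1 / of_nat m) ^ l))
     = (\<Prod>i<length [k, l]. 1 + of_int ([\<epsilon>, \<eta>] ! i) * (- 1) ^ (ms ! i)) /
        (\<Prod>i<length [k, l]. of_nat (ms ! i) ^ ([k, l] ! i) :: rat)"
    using ms by (auto simp: weight_def power_divide)
qed auto

text \<open>Either \<open>weight \<delta> a\<close> is 0, or \<delta> (-1)^a = 1 and this factor
  disappears from the second weight.\<close>

lemma weight_mult_weight_add:
  "\<delta> \<in> {1, -1} \<Longrightarrow> weight \<delta> a * weight (\<delta> * \<epsilon>) (a + c) = weight \<delta> a * weight \<epsilon> c"
  by (auto simp: weight_def power_add minus_one_power_iff)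

text \<open>For odd p the parities of c and p - c differ, which absorbs the sign in front of
  \<epsilon>; this is the source of -\<delta>2 in the theorem.\<close>

lemma weight_minus_diff: "odd p \<Longrightarrow> c \<le> p \<Longrightarrow> weight (- \<epsilon>) (p - c) = weight \<epsilon> c"
  by (auto simp: weight_def minus_one_power_iff)

lemma M_depth_2_add:
  assumes "\<delta> \<in> {1, -1}"
  shows "M N [k, l] [\<delta>, \<delta> * \<epsilon>] = (\<Sum>(a, c) \<in> triangle N.
    of_int (weight \<delta> a * weight \<epsilon> c) * ((1 / of_nat a) ^ k * (1 / of_nat (a + c)) ^ l))"
proof -
  have eq: "weight \<delta> a * weight (\<delta> * \<epsilon>) m = weight \<delta> a * weight \<epsilon> (m - a)" if "a < m" for a m
    using weight_mult_weight_add[OF assms, of a \<epsilon> "m - a"] that by simp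
  show ?thesis
    unfolding M_depth_2 triangle_def
    by (intro sum.reindex_bij_witness[where i = "\<lambda>(a, c). (a, a + c)" and j = "\<lambda>(a, m). (a, m - a)"])
       (auto simp: eq simp del: of_int_mult)
qed

lemma M_depth_2_diff:
  assumes "odd N"
  shows "M N [k, l] [\<delta>, - \<epsilon>] = (\<Sum>(a, c) \<in> triangle N.
    of_int (weight \<delta> a * weight \<epsilon> c) * ((1 / of_nat a) ^ k * (1 / of_nat (N - c)) ^ l))"
  unfolding M_depth_2 triangle_def
  by (rule sum.reindex_bij_witness[where i = "\<lambda>(a, c). (a, N - c)" and j = "\<lambda>(a, m). (a, N - m)"])
     (use assms weight_minus_diff[of N _ \<epsilon>, symmetric] in \<open>auto simp del: of_int_mult\<close>)

lemma sum_triangle_swap: "(\<Sum>(a, c) \<in> triangle N. f a c) = (\<Sum>(a, c) \<in> triangle N. f c a)"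
  by (rule sum.reindex_bij_witness[where i = prod.swap and j = prod.swap])
     (auto simp: triangle_def)

text \<open>This is an exact identity of rational numbers for every N; congruences enter only when
  the right-hand side of the theorem is compared with it.\<close>

lemma sum_M_eq_sum_triangle:
  assumes "\<delta>1 \<in> {1, -1}" and "\<delta>2 \<in> {1, -1}" and "n \<le> b"
  shows "(\<Sum>j=0..b. of_nat (j choose n) * M N [b - j + 1, j + 1] [\<delta>1, \<delta>1 * \<delta>2])
       + (\<Sum>j=0..b. of_nat (j choose (b - n)) * M N [b - j + 1, j + 1] [\<delta>2, \<delta>1 * \<delta>2])
       = (\<Sum>(a, c) \<in> triangle N. of_int (weight \<delta>1 a * weight \<delta>2 c) *
            ((1 / of_nat a) ^ (b - n + 1) * (1 / of_nat c) ^ (n + 1)))"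
proof -
  let ?w = "\<lambda>a c. of_int (weight \<delta>1 a * weight \<delta>2 c) :: rat"
  let ?B = "\<lambda>i a c k. binomial_power_sum (1 / of_nat i) (1 / of_nat (a + c)) b k :: rat"
  have "(\<Sum>j=0..b. of_nat (j choose n) * M N [b - j + 1, j + 1] [\<delta>1, \<delta>1 * \<delta>2])
      = (\<Sum>(a, c) \<in> triangle N. ?w a c * ?B a a c n)"
    unfolding M_depth_2_add[OF assms(1)] binomial_power_sum_def sum_distrib_left
    by (subst sum.swap) (simp add: case_prod_unfold mult_ac)
  moreover have "(\<Sum>j=0..b. of_nat (j choose (b - n)) * M N [b - j + 1, j + 1] [\<delta>2, \<delta>1 * \<delta>2])
      = (\<Sum>(a, c) \<in> triangle N. ?w a c * ?B c a c (b - n))"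
    \<comment> \<open>With \<delta>2 as leading sign, \<open>M_depth_2_add\<close> yields the
      weights with a and c interchanged; \<open>sum_triangle_swap\<close> restores the
      order.\<close>
    unfolding mult.commute[of \<delta>1 \<delta>2] M_depth_2_add[OF assms(2)] binomial_power_sum_def sum_distrib_left
    by (subst sum.swap, subst sum_triangle_swap) (simp add: case_prod_unfold mult_ac add_ac)
  moreover have "(1 / of_nat a) ^ (b - n + 1) * (1 / of_nat c) ^ (n + 1) = ?B a a c n + ?B c a c (b - n)"
    if "(a, c) \<in> triangle N" for a c
  proof -
    have "1 / of_nat (a + c) * (1 / of_nat a + 1 / of_nat c) = (1 / of_nat a * (1 / of_nat c) :: rat)"
    proof -
      have "of_nat a + of_nat c \<noteq> (0::rat)"
        using that by (simp add: triangle_def flip: of_nat_add)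
      then show ?thesis
        using that by (simp add: triangle_def divide_simps)
    qed
    from partial_fractions[OF this, of "b - n" n] show ?thesis
      using \<open>n \<le> b\<close> by simp
  qed
  then have "(\<Sum>(a, c) \<in> triangle N. ?w a c * ((1 / of_nat a) ^ (b - n + 1) * (1 / of_nat c) ^ (n + 1)))
      = (\<Sum>(a, c) \<in> triangle N. ?w a c * (?B a a c n + ?B c a c (b - n)))"
    by (intro sum.cong refl) (auto simp only: prod.case)
  ultimately show ?thesis
    by (simp only: case_prod_unfold distrib_left sum.distrib)
qed

section \<open>Comparison of the two sides modulo an odd prime\<close>

theorem corollary3p3:
  fixes b n :: nat and \<delta>1 \<delta>2 :: int
  assumes "\<delta>1 \<in> {1, -1}" and "\<delta>2 \<in> {1, -1}" and "n \<le> b"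
  shows "(\<Sum>j=0..b. of_nat (j choose n) * M_A [b - j + 1, j + 1] [\<delta>1, \<delta>1 * \<delta>2])
       + (\<Sum>j=0..b. of_nat (j choose (b - n)) * M_A [b - j + 1, j + 1] [\<delta>2, \<delta>1 * \<delta>2])
       = (-1) ^ (n + 1) * M_A [b - n + 1, n + 1] [\<delta>1, - \<delta>2]"
  unfolding M_A_def residue_class_def[symmetric] residue_class_of_nat_mult residue_class_sum residue_class_add
    residue_class_sign_mult
proof (rule residue_class_eqI)
  fix p :: nat assume p: "prime p" and "p \<noteq> 2"
  then have "odd p"
    using prime_odd_nat prime_ge_2_nat by (metis le_neq_implies_less)
  define v where "v c = modular_inverse (int p) (int c)" for c
  have not_dvd: "\<not> int p dvd int c" if "0 < c" "c < p" for c
    using that by (simp add: nat_dvd_not_less)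
  have v: "[v c * int c = 1] (mod int p)" if "0 < c" "c < p" for c
  proof -
    have "coprime (int p) (int c)"
      using not_dvd[OF that] p by (simp add: prime_imp_coprime)
    then show ?thesis
      using p by (simp add: v_def cong_modular_inverse2 coprime_commute prime_gt_0_nat)
  qed
  have inv: "has_residue p (1 / of_nat c) (v c)" if "0 < c" "c < p" for c
    using has_residue_inverse[OF not_dvd v] that by simp
  \<comment> \<open>Since p - c is congruent to -c, its inverse is \<open>- v c\<close>; its power n
    + 1 produces the sign in the theorem.\<close>
  have inv_diff: "has_residue p (1 / of_nat (p - c)) (- v c)" if "0 < c" "c < p" for c
  proof -
    have "[- v c * int (p - c) = 1] (mod int p)"
    proof -
      have "- v c * int (p - c) = v c * int c + int p * (- v c)"
        using that by (simp add: of_nat_diff algebra_simps)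
      then show ?thesis
        using v[OF that] by (simp only: cong_def mod_mult_self2)
    qed
    with has_residue_inverse[of p "int (p - c)" "- v c"] not_dvd[of "p - c"] that show ?thesis
      by simp
  qed
  note residue_intros = has_residue_add has_residue_mult has_residue_power has_residue_sum
    has_residue_of_int p
  let ?w = "\<lambda>a c. weight \<delta>1 a * weight \<delta>2 c"
  \<comment> \<open>\<open>?Q\<close> is the exact value of the left-hand side before reduction, and
    \<open>?q\<close> is the same expression with each reciprocal replaced by an inverse modulo
    p.\<close>
  let ?Q = "\<Sum>(a, c) \<in> triangle p. of_int (?w a c) *
            ((1 / of_nat a) ^ (b - n + 1) * (1 / of_nat c) ^ (n + 1)) :: rat"
  let ?q = "\<Sum>(a, c) \<in> triangle p. ?w a c * (v a ^ (b - n + 1) * v c ^ (n + 1))"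
  \<comment> \<open>\<open>mod_prime\<close> returns a true residue only if one exists; the inverses
    \<open>v\<close> supply it.\<close>
  have M_res: "has_residue p (M p [k, l] [\<epsilon>, \<eta>]) (mod_prime p (M p [k, l] [\<epsilon>, \<eta>]))" for k l \<epsilon> \<eta>
  proof -
    have "has_residue p (M p [k, l] [\<epsilon>, \<eta>]) (\<Sum>(a, m) | 0 < a \<and> a < m \<and> m < p.
        weight \<epsilon> a * weight \<eta> m * (v a ^ k * v m ^ l))"
      unfolding M_depth_2 case_prod_unfold by (intro residue_intros inv) auto
    then show ?thesis
      using has_residue_mod_prime p by blast
  qed
  have of_nat_res: "has_residue p (of_nat k) (int k)" for k
    using has_residue_of_int[OF p, of "int k"] by simp
  have "has_residue p ((\<Sum>j=0..b. of_nat (j choose n) * M p [b - j + 1, j + 1] [\<delta>1, \<delta>1 * \<delta>2])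
       + (\<Sum>j=0..b. of_nat (j choose (b - n)) * M p [b - j + 1, j + 1] [\<delta>2, \<delta>1 * \<delta>2]))
      ((\<Sum>j=0..b. int (j choose n) * mod_prime p (M p [b - j + 1, j + 1] [\<delta>1, \<delta>1 * \<delta>2]))
       + (\<Sum>j=0..b. int (j choose (b - n)) * mod_prime p (M p [b - j + 1, j + 1] [\<delta>2, \<delta>1 * \<delta>2])))"
    (is "has_residue p _ ?l")
    by (intro residue_intros M_res of_nat_res)
  then have "has_residue p ?Q ?l"
    by (simp only: sum_M_eq_sum_triangle[OF assms])
  moreover have "has_residue p ?Q ?q"
    unfolding case_prod_unfold by (intro residue_intros inv) (auto simp: triangle_def)
  ultimately have l: "[?l = ?q] (mod int p)"
    using has_residue_unique p by blast
  have "has_residue p (M p [b - n + 1, n + 1] [\<delta>1, - \<delta>2])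
      (\<Sum>(a, c) \<in> triangle p. ?w a c * (v a ^ (b - n + 1) * (- v c) ^ (n + 1)))"
    unfolding M_depth_2_diff[OF \<open>odd p\<close>] case_prod_unfold
    by (intro residue_intros inv inv_diff) (auto simp: triangle_def)
  also have "(\<Sum>(a, c) \<in> triangle p. ?w a c * (v a ^ (b - n + 1) * (- v c) ^ (n + 1))) = (-1) ^ (n + 1) * ?q"
    unfolding sum_distrib_left case_prod_unfold
    by (intro sum.cong refl) (simp add: power_minus[of "v c" n for c] mult_ac)
  finally have "[mod_prime p (M p [b - n + 1, n + 1] [\<delta>1, - \<delta>2]) = (-1) ^ (n + 1) * ?q] (mod int p)"
    using has_residue_unique[OF p M_res] by blast
  \<comment> \<open>The sign has to move to the other side of the congruence, so multiply by it once
    more and use that its square is 1.\<close>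
  then have "[(-1) ^ (n + 1) * mod_prime p (M p [b - n + 1, n + 1] [\<delta>1, - \<delta>2])
      = (-1) ^ (n + 1) * ((-1) ^ (n + 1) * ?q)] (mod int p)"
    by (intro cong_mult cong_refl)
  also have "(-1) ^ (n + 1) * ((-1) ^ (n + 1) * ?q) = ?q"
    by (simp flip: mult.assoc power_mult_distrib)
  finally show "[?l = (-1) ^ (n + 1) * mod_prime p (M p [b - n + 1, n + 1] [\<delta>1, - \<delta>2])] (mod int p)"
    using l cong_sym cong_trans by blast
qed

end
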